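(* Let $L$ be a finite lattice and let $\tilde L$ be as in the context. Let $T'$ be a left-semicontinuous t-norm on $\tilde L$. If the restriction $T'|_L$ of $T'$ to $L\times L$ is a t-norm on $L$, then $T'|_L$ is left-semicontinuous.
   Context: For a lattice $L$ with bottom $0$: an atom is an element covering $0$; $A(L)$ is the set of atoms; $J(L)$ the set of non-zero join-irreducible elements; $H(L)=J(L)\setminus A(L)$. $\tilde L$ is obtained from the finite lattice $L$ by adding, for each $p\in H(L)$, a new distinct element $w_p$ with $0\prec w_p\prec p$ (so $w_p\le x$ for $x\in L$ iff $p\le x$); $\tilde L$ is a finite atomistic lattice containing $L$ as a sublattice with the same $0$ and $1$. A t-norm on a bounded lattice is a binary operation that is monotone in each argument, commutative, associative, with neutral element $1$. A t-norm $T$ on a complete lattice $M$ is left-semicontinuous if $T(a,\bigvee S)=\bigvee_{x\in S}T(a,x)$ for every $a\in M$ and every $S\subseteq M$ with $\bigvee S\ne1$. *)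

theory Defs
  imports "HOL-Library.Finite_Lattice"
begin

definition covers :: "'a::order \<Rightarrow> 'a \<Rightarrow> bool" where
  "covers x y \<longleftrightarrow> x < y \<and> \<not> (\<exists>z. x < z \<and> z < y)"

definition atoms :: "'a::order_bot set" where
  "atoms = {x. covers bot x}"

definition join_irreducibles :: "'a::bounded_lattice_bot set" where
  "join_irreducibles = {x. x \<noteq> bot \<and> (\<forall>a b. x = sup a b \<longrightarrow> x = a \<or> x = b)}"

definition nonatomic_irreducibles :: "'a::bounded_lattice_bot set" where
  "nonatomic_irreducibles = join_irreducibles - atoms"

text \<open>
  The elements of the extended lattice are \<open>Inl x\<close> for every \<open>x\<close> of the given lattice and
  \<open>Inr p\<close>, in the role of \<open>w\<^sub>p\<close>, for every \<open>p\<close> in \<open>H(L)\<close>.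
\<close>

typedef (overloaded) 'a tilde =
  "range Inl \<union> Inr ` nonatomic_irreducibles :: ('a::finite_lattice_complete + 'a) set"
  by blast

setup_lifting type_definition_tilde

text \<open>
  \<open>old\<close> is the inclusion of the given lattice. The value of \<open>new p\<close> for \<open>p\<close> outside
  \<open>nonatomic_irreducibles\<close> is junk.
\<close>

lift_definition old :: "'a::finite_lattice_complete \<Rightarrow> 'a tilde" is Inl
  by blast

definition new :: "'a::finite_lattice_complete \<Rightarrow> 'a tilde" where
  "new p = Abs_tilde (Inr p)"

text \<open>
  The order is generated by that of the given lattice and \<open>0 < w\<^sub>p < p\<close>: an old element lies
  below \<open>w\<^sub>p\<close> only if it is \<open>0\<close>, and distinct new elements are incomparable.
\<close>

fun tilde_le :: "'a::finite_lattice_complete + 'a \<Rightarrow> 'a + 'a \<Rightarrow> bool" where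
  "tilde_le (Inl x) (Inl y) = (x \<le> y)"
| "tilde_le (Inr p) (Inl y) = (p \<le> y)"
| "tilde_le (Inl x) (Inr q) = (x = bot)"
| "tilde_le (Inr p) (Inr q) = (p = q)"

fun tilde_sup :: "'a::finite_lattice_complete + 'a \<Rightarrow> 'a + 'a \<Rightarrow> 'a + 'a" where
  "tilde_sup (Inl x) (Inl y) = Inl (sup x y)"
| "tilde_sup (Inr p) (Inl y) = (if y = bot then Inr p else Inl (sup p y))"
| "tilde_sup (Inl x) (Inr q) = (if x = bot then Inr q else Inl (sup x q))"
| "tilde_sup (Inr p) (Inr q) = (if p = q then Inr p else Inl (sup p q))"

fun tilde_inf :: "'a::finite_lattice_complete + 'a \<Rightarrow> 'a + 'a \<Rightarrow> 'a + 'a" where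
  "tilde_inf (Inl x) (Inl y) = Inl (inf x y)"
| "tilde_inf (Inr p) (Inl y) = (if p \<le> y then Inr p else Inl bot)"
| "tilde_inf (Inl x) (Inr q) = (if q \<le> x then Inr q else Inl bot)"
| "tilde_inf (Inr p) (Inr q) = (if p = q then Inr p else Inl bot)"

lemma nonatomic_irreducibles_not_bot: "p \<in> nonatomic_irreducibles \<Longrightarrow> p \<noteq> bot"
  by (auto simp: nonatomic_irreducibles_def join_irreducibles_def)

instantiation tilde :: (finite_lattice_complete) lattice
begin

lift_definition less_eq_tilde :: "'a tilde \<Rightarrow> 'a tilde \<Rightarrow> bool" is tilde_le .

definition less_tilde :: "'a tilde \<Rightarrow> 'a tilde \<Rightarrow> bool" where
  "less_tilde x y \<longleftrightarrow> x \<le> y \<and> \<not> y \<le> x"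

lift_definition sup_tilde :: "'a tilde \<Rightarrow> 'a tilde \<Rightarrow> 'a tilde" is tilde_sup
  by (auto split: if_splits)

lift_definition inf_tilde :: "'a tilde \<Rightarrow> 'a tilde \<Rightarrow> 'a tilde" is tilde_inf
  by (auto split: if_splits)

instance
proof
  fix x y z :: "'a tilde"
  show "(x < y) = (x \<le> y \<and> \<not> y \<le> x)" by (rule less_tilde_def)
  show "x \<le> x" by transfer auto
  show "x \<le> y \<Longrightarrow> y \<le> z \<Longrightarrow> x \<le> z"
    by transfer (auto dest: nonatomic_irreducibles_not_bot simp: bot_unique)
  show "x \<le> y \<Longrightarrow> y \<le> x \<Longrightarrow> x = y"
    by transfer (auto dest: nonatomic_irreducibles_not_bot simp: bot_unique)
  show "inf x y \<le> x" "inf x y \<le> y"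
    by (transfer, auto)+
  show "x \<le> y \<Longrightarrow> x \<le> z \<Longrightarrow> x \<le> inf y z"
    by transfer (auto dest: nonatomic_irreducibles_not_bot simp: bot_unique)
  show "x \<le> sup x y" "y \<le> sup x y"
    by (transfer, auto)+
  show "y \<le> x \<Longrightarrow> z \<le> x \<Longrightarrow> sup y z \<le> x"
    by transfer (auto dest: nonatomic_irreducibles_not_bot simp: bot_unique)
qed

end

instance tilde :: (finite_lattice_complete) finite
proof
  show "finite (UNIV :: 'a tilde set)"
    by (rule finite_imageD[of Rep_tilde]) (simp_all add: inj_on_def Rep_tilde_inject)
qed

instantiation tilde :: (finite_lattice_complete) finite_lattice_complete
begin

definition bot_tilde :: "'a tilde" where "bot_tilde = Inf_fin UNIV"

definition top_tilde :: "'a tilde" where "top_tilde = Sup_fin UNIV"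

definition Inf_tilde :: "'a tilde set \<Rightarrow> 'a tilde" where
  "Inf_tilde A = Finite_Set.fold inf top A"

definition Sup_tilde :: "'a tilde set \<Rightarrow> 'a tilde" where
  "Sup_tilde A = Finite_Set.fold sup bot A"

instance
  by standard (rule bot_tilde_def top_tilde_def Inf_tilde_def Sup_tilde_def)+

end

lemma old_inject: "old x = old y \<longleftrightarrow> x = y"
  by transfer simp

lemma old_le_iff: "old x \<le> old y \<longleftrightarrow> x \<le> y"
  by transfer simp

lemma old_sup: "old (sup x y) = sup (old x) (old y)"
  by transfer simp

lemma old_inf: "old (inf x y) = inf (old x) (old y)"
  by transfer simp

lemma old_bot: "old (bot :: 'a::finite_lattice_complete) = bot"
proof -
  have "old bot \<le> z" for z :: "'a tilde" by transfer auto
  then show ?thesis by (rule bot_unique[THEN iffD1])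
qed

lemma old_top: "old (top :: 'a::finite_lattice_complete) = top"
proof -
  have "z \<le> old top" for z :: "'a tilde" by transfer auto
  then show ?thesis by (rule top_unique[THEN iffD1])
qed

lemma Rep_new: "p \<in> nonatomic_irreducibles \<Longrightarrow> Rep_tilde (new p) = Inr p"
  by (simp add: new_def Abs_tilde_inverse)

lemma new_inject:
  "p \<in> nonatomic_irreducibles \<Longrightarrow> q \<in> nonatomic_irreducibles \<Longrightarrow> new p = new q \<longleftrightarrow> p = q"
  by (metis Rep_new sum.inject(2))

lemma new_not_old: "p \<in> nonatomic_irreducibles \<Longrightarrow> new p \<noteq> old x"
  by (metis Rep_new old.rep_eq sum.distinct(1))

lemma tilde_cases:
  obtains (old) x where "z = old x"
    | (new) p where "p \<in> nonatomic_irreducibles" "z = new p"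
proof -
  have "(\<exists>x. Rep_tilde z = Inl x) \<or> (\<exists>p\<in>nonatomic_irreducibles. Rep_tilde z = Inr p)"
    using Rep_tilde[of z] by auto
  then show thesis
    by (metis Rep_new Rep_tilde_inject old.rep_eq that)
qed

lemma new_le_old_iff: "p \<in> nonatomic_irreducibles \<Longrightarrow> new p \<le> old x \<longleftrightarrow> p \<le> x"
  by (simp add: less_eq_tilde.rep_eq Rep_new old.rep_eq)

lemma old_le_new_iff: "p \<in> nonatomic_irreducibles \<Longrightarrow> old x \<le> new p \<longleftrightarrow> x = bot"
  by (simp add: less_eq_tilde.rep_eq Rep_new old.rep_eq)

lemma new_le_new_iff:
  "p \<in> nonatomic_irreducibles \<Longrightarrow> q \<in> nonatomic_irreducibles \<Longrightarrow> new p \<le> new q \<longleftrightarrow> p = q"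
  by (simp add: less_eq_tilde.rep_eq Rep_new)

lemmas tilde_le_iffs = old_le_iff new_le_old_iff old_le_new_iff new_le_new_iff

lemma covers_bot_new:
  assumes "p \<in> nonatomic_irreducibles"
  shows "covers bot (new p)"
proof -
  have "z = bot \<or> z = new p" if "z \<le> new p" for z
    using that assms by (cases z rule: tilde_cases) (auto simp: tilde_le_iffs old_bot)
  moreover have "new p \<noteq> bot"
    using assms new_not_old[of p bot] by (simp add: old_bot)
  ultimately show ?thesis
    unfolding covers_def by (metis bot.not_eq_extremum order_less_le)
qed

lemma covers_new_old:
  assumes "p \<in> nonatomic_irreducibles"
  shows "covers (new p) (old p)"
proof -
  have "z = new p \<or> z = old p" if "new p \<le> z" "z \<le> old p" for z
    using that assms by (cases z rule: tilde_cases) (auto simp: tilde_le_iffs)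
  then show ?thesis
    unfolding covers_def using assms
    by (metis new_le_old_iff new_not_old order.refl order_less_le)
qed

lemma tilde_atomistic: "Sup {a \<in> atoms. a \<le> z} = z" for z :: "'a::finite_lattice_complete tilde"
proof (rule antisym)
  show "Sup {a \<in> atoms. a \<le> z} \<le> z" by (rule Sup_least) simp
  have "z \<le> b" if "\<And>a. a \<in> atoms \<Longrightarrow> a \<le> z \<Longrightarrow> a \<le> b" for b
    using that
  proof (induction "card {y. y < z}" arbitrary: z rule: less_induct)
    case less
    have below: "y \<le> b" if "y < z" for y
    proof (rule less.hyps)
      show "card {u. u < y} < card {u. u < z}"
        using that by (intro psubset_card_mono) auto
      show "a \<le> b" if "a \<in> atoms" "a \<le> y" for a
        using that \<open>y < z\<close> less.prems by (meson less_imp_le order_trans)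
    qed
    show ?case
    proof (cases "z = bot \<or> z \<in> atoms")
      case True
      then show ?thesis using less.prems by auto
    next
      case False
      then obtain x where z: "z = old x"
        by (metis tilde_cases covers_bot_new atoms_def mem_Collect_eq)
      have x: "x \<noteq> bot" using False z old_bot by auto
      show ?thesis
      proof (cases "x \<in> join_irreducibles")
        case True
        show ?thesis
        proof (cases "x \<in> atoms")
          case False
          then have H: "x \<in> nonatomic_irreducibles"
            using True by (simp add: nonatomic_irreducibles_def)
          obtain y where y: "bot < y" "y < x"
            using False x by (auto simp: atoms_def covers_def bot.not_eq_extremum)
          have "old y \<le> b"
            using below[of "old y"] y z by (simp add: less_le old_le_iff old_inject)
          moreover have "new x \<le> b"
            using below[of "new x"] H z covers_new_old[OF H] by (simp add: covers_def)
          ultimately show ?thesis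
            using H y z by (cases b rule: tilde_cases) (auto simp: tilde_le_iffs)
        next
          case True
          have "z \<in> atoms"
          proof -
            have "u = bot \<or> u = z" if "u \<le> z" for u
            proof (cases u rule: tilde_cases)
              case (old y)
              then show ?thesis using that True z
                by (auto simp: old_le_iff atoms_def covers_def old_bot less_le)
            next
              case (new p)
              then have "p \<le> x" "p \<noteq> bot" "p \<notin> atoms"
                using that z by (auto simp: new_le_old_iff nonatomic_irreducibles_def
                    join_irreducibles_def)
              then show ?thesis using True
                by (metis atoms_def covers_def mem_Collect_eq bot.not_eq_extremum order_less_le)
            qed
            then show ?thesis
              using \<open>\<not> (z = bot \<or> z \<in> atoms)\<close>
              by (metis atoms_def covers_def mem_Collect_eq bot.not_eq_extremum order_less_le)
          qed
          then show ?thesis using less.prems by auto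
        qed
      next
        case False
        then obtain u v where uv: "x = sup u v" "x \<noteq> u" "x \<noteq> v"
          using x by (auto simp: join_irreducibles_def)
        then have "old u < z" "old v < z"
          using z by (auto simp: less_le old_le_iff old_inject)
        then have "sup (old u) (old v) \<le> b" using below by simp
        then show ?thesis using z uv by (simp add: old_sup)
      qed
    qed
  qed
  then show "z \<le> Sup {a \<in> atoms. a \<le> z}" by (simp add: Sup_upper)
qed

definition tnorm :: "('a::bounded_lattice \<Rightarrow> 'a \<Rightarrow> 'a) \<Rightarrow> bool" where
  "tnorm T \<longleftrightarrow>
    (\<forall>a b c. b \<le> c \<longrightarrow> T a b \<le> T a c) \<and>
    (\<forall>a b c. b \<le> c \<longrightarrow> T b a \<le> T c a) \<and>
    (\<forall>a b. T a b = T b a) \<and>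
    (\<forall>a b c. T (T a b) c = T a (T b c)) \<and>
    (\<forall>a. T a top = a \<and> T top a = a)"

definition left_semicontinuous :: "('a::complete_lattice \<Rightarrow> 'a \<Rightarrow> 'a) \<Rightarrow> bool" where
  "left_semicontinuous T \<longleftrightarrow>
    (\<forall>a S. Sup S \<noteq> top \<longrightarrow> T a (Sup S) = (SUP x\<in>S. T a x))"

text \<open>
  \<open>restricts_to T' T\<close>: the given lattice, viewed inside the extended one via \<open>old\<close>, is closed
  under \<open>T'\<close>, and \<open>T\<close> is the operation that \<open>T'\<close> induces on it. Since \<open>old\<close> is injective,
  \<open>T\<close> is determined by \<open>T'\<close>.
\<close>

definition restricts_to ::
  "('a::finite_lattice_complete tilde \<Rightarrow> 'a tilde \<Rightarrow> 'a tilde) \<Rightarrow> ('a \<Rightarrow> 'a \<Rightarrow> 'a) \<Rightarrow> bool" where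
  "restricts_to T' T \<longleftrightarrow> (\<forall>x y. T' (old x) (old y) = old (T x y))"

end

theory Submission
  imports Defs
begin

text \<open>In a finite lattice every join is built from \<open>bot\<close> and binary joins, and
  \<open>old\<close> preserves both; the shared bottom settles the empty join.\<close>

lemma old_Sup: "old (Sup S) = Sup (old ` S)"
proof -
  have "finite S" by simp
  then show ?thesis
    by (induction S) (simp_all add: old_bot old_sup)
qed

theorem theorem6p6:
  fixes T' :: "'a::finite_lattice_complete tilde \<Rightarrow> 'a tilde \<Rightarrow> 'a tilde"
    and T :: "'a \<Rightarrow> 'a \<Rightarrow> 'a"
  assumes "tnorm T'" and "left_semicontinuous T'"
    and "restricts_to T' T" and "tnorm T"
  shows "left_semicontinuous T"
  unfolding left_semicontinuous_def
proof (intro allI impI)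
  fix a :: 'a and S :: "'a set"
  assume "Sup S \<noteq> top"
  \<comment> \<open>Both lattices share their top and \<open>old\<close> is injective, so the side
    condition of left-semicontinuity transfers to \<open>T'\<close>.\<close>
  then have not_top: "Sup (old ` S) \<noteq> top"
    by (metis old_Sup old_inject old_top)
  have T': "T' (old x) (old y) = old (T x y)" for x y
    using assms(3) by (simp add: restricts_to_def)
  have "old (T a (Sup S)) = T' (old a) (Sup (old ` S))"
    by (simp add: T' flip: old_Sup)
  also have "\<dots> = (SUP x\<in>old ` S. T' (old a) x)"
    using assms(2) not_top unfolding left_semicontinuous_def by blast
  also have "\<dots> = old (SUP x\<in>S. T a x)"
    by (simp add: T' old_Sup image_image)
  finally show "T a (Sup S) = (SUP x\<in>S. T a x)"
    by (simp add: old_inject)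
qed

end
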